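(* Let $(Z_n)_{n\ge 0}$ be a real-valued centered process with stationary increments (so $\mathbb E[Z_n]=0$ for every $n$). Then for every $a>0$ and every integer $n\ge 1$, $$\mathbb P\left(Z_n^*\le -a\right)\le \frac{\mathbb E\left[Z_{n+1}^*\right]}{a\,n}.$$
   Context: A discrete-time process $(Z_n)_{n\ge 0}$ has stationary increments if for every integer $k\ge 0$ the sequences $(Z_{n+k}-Z_k)_{n\ge 0}$ and $(Z_n)_{n\ge 0}$ have the same law (in particular $Z_0=0$ almost surely). Centered means that each $Z_n$ is integrable with zero mean. Notation: $Z_n^*:=\max_{k=1,\ldots,n}Z_k$. *)

theory Defs
  imports "HOL-Probability.Probability"
begin

text \<open>Laws of sequences are measures on the countable product of the Borel sigma-algebra.
  As \<^const>\<open>distr\<close> is only meaningful for measurable maps, these definitions are to be used for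
  processes all of whose coordinates are Borel measurable.\<close>

definition process_law :: "'a measure \<Rightarrow> (nat \<Rightarrow> 'a \<Rightarrow> real) \<Rightarrow> (nat \<Rightarrow> real) measure" where
  "process_law M X = distr M (\<Pi>\<^sub>M n\<in>UNIV. borel) (\<lambda>\<omega> n. X n \<omega>)"

definition stationary_increments :: "'a measure \<Rightarrow> (nat \<Rightarrow> 'a \<Rightarrow> real) \<Rightarrow> bool" where
  "stationary_increments M Z \<longleftrightarrow>
    (\<forall>k. process_law M (\<lambda>n \<omega>. Z (n + k) \<omega> - Z k \<omega>) = process_law M Z)"

definition centered :: "'a measure \<Rightarrow> (nat \<Rightarrow> 'a \<Rightarrow> real) \<Rightarrow> bool" where
  "centered M Z \<longleftrightarrow> (\<forall>n. integrable M (Z n) \<and> integral\<^sup>L M (Z n) = 0)"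

text \<open>The index starts at 1, so the value at \<open>n = 0\<close> is unspecified.\<close>

definition running_max :: "(nat \<Rightarrow> 'a \<Rightarrow> real) \<Rightarrow> nat \<Rightarrow> 'a \<Rightarrow> real" where
  "running_max Z n \<omega> = Max ((\<lambda>k. Z k \<omega>) ` {1..n})"

end

theory Submission
  imports Defs
begin

text \<open>Call \<open>k\<close> a drop time if \<open>Z (k + i) \<le> Z k - a\<close> for all \<open>1 \<le> i \<le> n\<close>. Stationarity gives each
  \<open>k\<close> the same probability of being a drop time, namely that of \<open>running_max Z n \<le> - a\<close>. Any two
  drop times in \<open>{1..n}\<close> are at distance less than \<open>n\<close>, so the values of \<open>Z\<close> at successive drop
  times decrease by at least \<open>a\<close>, and the last of them exceeds \<open>Z (n + 1)\<close> by at least \<open>a\<close>. Hence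
  \<open>running_max Z (n + 1)\<close> is at least \<open>Z (n + 1)\<close> plus \<open>a\<close> times the number of drop times in
  \<open>{1..n}\<close>; now take expectations.\<close>

lemma running_max_le_iff:
  assumes "n \<ge> 1"
  shows "running_max Z n \<omega> \<le> c \<longleftrightarrow> (\<forall>i\<in>{1..n}. Z i \<omega> \<le> c)"
  using assms unfolding running_max_def by (subst Max_le_iff) auto

lemma running_max_ge:
  assumes "i \<in> {1..n}"
  shows "Z i \<omega> \<le> running_max Z n \<omega>"
  using assms unfolding running_max_def by (intro Max_ge) auto

lemma integrable_running_max:
  assumes "n \<ge> 1" and "\<And>i. integrable M (Z i)"
  shows "integrable M (running_max Z n)"
  using assms(1)
proof (induction n rule: dec_induct)
  case base
  have "running_max Z 1 = Z 1"
    by (auto simp: running_max_def)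
  then show ?case
    using assms(2) by simp
next
  case (step m)
  then have "running_max Z (Suc m) = (\<lambda>\<omega>. max (Z (Suc m) \<omega>) (running_max Z m \<omega>))"
    by (auto simp: running_max_def atLeastAtMostSuc_conv)
  then show ?case
    using step.IH assms(2) by (simp add: integrable_max)
qed

text \<open>Downward induction on \<open>j\<close>, keeping an index \<open>i\<close> with
  \<open>z i\<close> at least \<open>z m\<close> plus \<open>a\<close> per drop time met so far. A
  new drop time \<open>j\<close> has \<open>z j\<close> at least \<open>a\<close> above every later
  value up to \<open>m\<close>, in particular above \<open>z i\<close>, so \<open>j\<close> becomes
  the witness; otherwise \<open>i\<close> is kept.\<close>

lemma exists_ge_last_plus_drops:
  fixes z :: "nat \<Rightarrow> real"
  assumes "j \<le> m"
  shows "\<exists>i\<in>{j..m}. z m + a * (\<Sum>k=j..<m. of_bool (\<forall>i\<in>{k<..m}. z i \<le> z k - a)) \<le> z i"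
  using assms
proof (induction j rule: inc_induct)
  case base
  then show ?case by simp
next
  case (step j)
  let ?d = "\<lambda>k. \<forall>i\<in>{k<..m}. z i \<le> z k - a"
  obtain i where i: "i \<in> {Suc j..m}" "z m + a * (\<Sum>k=Suc j..<m. of_bool (?d k)) \<le> z i"
    using step.IH by blast
  have split: "(\<Sum>k=j..<m. of_bool (?d k)) =
      (of_bool (?d j) + (\<Sum>k=Suc j..<m. of_bool (?d k)) :: real)"
    using step.hyps(2) by (rule sum.atLeast_Suc_lessThan)
  show ?case
  proof (cases "?d j")
    case True
    then have "z i \<le> z j - a"
      using i(1) by simp
    then have "z m + a * (\<Sum>k=j..<m. of_bool (?d k)) \<le> z j"
      using i(2) True unfolding split by (simp add: distrib_left)
    then show ?thesis
      using step.hyps by force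
  next
    case False
    then show ?thesis
      using i unfolding split by (intro bexI[of _ i]) auto
  qed
qed

text \<open>For \<open>k\<close> in \<open>{1..n}\<close> the window of \<open>n\<close> steps after
  \<open>k\<close> reaches at least to \<open>n + 1\<close>, because \<open>k \<ge> 1\<close>. Hence
  a drop over \<open>n\<close> steps is a drop up to \<open>n + 1\<close>, and
  \<open>exists_ge_last_plus_drops\<close> applies with \<open>m = n + 1\<close>.\<close>

lemma running_max_ge_last_plus_drops:
  assumes "a > 0"
  shows "Z (n + 1) \<omega> + a * (\<Sum>k=1..n. of_bool (\<forall>i\<in>{1..n}. Z (i + k) \<omega> - Z k \<omega> \<le> - a))
    \<le> running_max Z (n + 1) \<omega>"
proof -
  obtain i where i: "i \<in> {1..n + 1}"
    "Z (n + 1) \<omega> + a * (\<Sum>k=1..<n + 1. of_bool (\<forall>i\<in>{k<..n + 1}. Z i \<omega> \<le> Z k \<omega> - a)) \<le> Z i \<omega>"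
    using exists_ge_last_plus_drops[of 1 "n + 1" "\<lambda>i. Z i \<omega>" a] by auto
  have "(\<Sum>k=1..n. of_bool (\<forall>i\<in>{1..n}. Z (i + k) \<omega> - Z k \<omega> \<le> - a))
    \<le> (\<Sum>k=1..<n + 1. of_bool (\<forall>i\<in>{k<..n + 1}. Z i \<omega> \<le> Z k \<omega> - a) :: real)"
  \<comment> \<open>Termwise comparison over \<open>{1..n}\<close>; what is left at the end only
    rewrites \<open>{1..<n + 1}\<close>.\<close>
  proof (rule order_trans[OF sum_mono])
    fix k assume k: "k \<in> {1..n}"
    have "Z i \<omega> \<le> Z k \<omega> - a"
      if d: "\<forall>i\<in>{1..n}. Z (i + k) \<omega> - Z k \<omega> \<le> - a" and i: "i \<in> {k<..n + 1}" for i
    proof -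
      have "i - k \<in> {1..n}" and "i - k + k = i"
        using k i by auto
      then show ?thesis
        using d by fastforce
    qed
    then show "of_bool (\<forall>i\<in>{1..n}. Z (i + k) \<omega> - Z k \<omega> \<le> - a)
        \<le> (of_bool (\<forall>i\<in>{k<..n + 1}. Z i \<omega> \<le> Z k \<omega> - a) :: real)"
      by (auto simp: of_bool_def)
  qed (simp add: atLeastLessThanSuc_atLeastAtMost)
  then have "a * (\<Sum>k=1..n. of_bool (\<forall>i\<in>{1..n}. Z (i + k) \<omega> - Z k \<omega> \<le> - a))
    \<le> a * (\<Sum>k=1..<n + 1. of_bool (\<forall>i\<in>{k<..n + 1}. Z i \<omega> \<le> Z k \<omega> - a))"
    using assms by (intro mult_left_mono) auto
  then show ?thesis
    using i(2) running_max_ge[of i "n + 1" Z \<omega>, OF i(1)] by linarith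
qed

lemma measure_process_law:
  assumes [measurable]: "\<And>k. X k \<in> borel_measurable M"
    and "{x. P x} \<in> sets (\<Pi>\<^sub>M n\<in>UNIV. borel)"
  shows "measure (process_law M X) {x. P x} = measure M {\<omega> \<in> space M. P (\<lambda>n. X n \<omega>)}"
proof -
  have "(\<lambda>\<omega> n. X n \<omega>) \<in> measurable M (\<Pi>\<^sub>M n\<in>UNIV. borel)"
    by (intro measurable_PiM_single') auto
  then have "measure (process_law M X) {x. P x}
      = measure M ((\<lambda>\<omega> n. X n \<omega>) -` {x. P x} \<inter> space M)"
    unfolding process_law_def using assms(2) by (intro measure_distr) auto
  also have "(\<lambda>\<omega> n. X n \<omega>) -` {x. P x} \<inter> space M = {\<omega> \<in> space M. P (\<lambda>n. X n \<omega>)}"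
    by auto
  finally show ?thesis .
qed

text \<open>\<open>P\<close> is a predicate on whole paths, so the equality of laws transfers events
  that involve several times jointly, such as a drop over \<open>n\<close> steps.\<close>

lemma stationary_increments_measure_eq:
  assumes [measurable]: "\<And>k. Z k \<in> borel_measurable M"
    and "stationary_increments M Z"
    and "{x. P x} \<in> sets (\<Pi>\<^sub>M n\<in>UNIV. borel)"
  shows "measure M {\<omega> \<in> space M. P (\<lambda>n. Z (n + k) \<omega> - Z k \<omega>)}
    = measure M {\<omega> \<in> space M. P (\<lambda>n. Z n \<omega>)}"
  using assms(2) measure_process_law[of Z M P, OF assms(1,3)]
    measure_process_law[of "\<lambda>n \<omega>. Z (n + k) \<omega> - Z k \<omega>" M P, OF _ assms(3)]
  unfolding stationary_increments_def by simp

theorem theorem2: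
  fixes M :: "'a measure" and Z :: "nat \<Rightarrow> 'a \<Rightarrow> real" and a :: real and n :: nat
  assumes "prob_space M"
    and "\<And>k. Z k \<in> borel_measurable M"
    and "centered M Z"
    and "stationary_increments M Z"
    and "a > 0"
    and "n \<ge> 1"
  shows "measure M {\<omega> \<in> space M. running_max Z n \<omega> \<le> - a}
      \<le> integral\<^sup>L M (running_max Z (n + 1)) / (a * real n)"
proof -
  interpret prob_space M by fact
  note [measurable] = assms(2)
  define D where "D k = {\<omega> \<in> space M. \<forall>i\<in>{1..n}. Z (i + k) \<omega> - Z k \<omega> \<le> - a}" for k
  let ?p = "prob {\<omega> \<in> space M. running_max Z n \<omega> \<le> - a}"
  have D [measurable]: "D k \<in> events" for k
    unfolding D_def by measurable
  have "{x \<in> space (\<Pi>\<^sub>M n\<in>UNIV. borel). \<forall>i\<in>{1..n}. x i \<le> - a}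
      \<in> sets (\<Pi>\<^sub>M n\<in>(UNIV::nat set). (borel :: real measure))"
    by measurable
  then have "{x. \<forall>i\<in>{1..n}. x i \<le> - a}
      \<in> sets (\<Pi>\<^sub>M n\<in>(UNIV::nat set). (borel :: real measure))"
    by (simp add: space_PiM)
  then have prob_D: "prob (D k) = ?p" for k
    unfolding D_def running_max_le_iff[OF assms(6)]
    by (rule stationary_increments_measure_eq[OF assms(2,4)])
  have Z: "integrable M (Z i)" "expectation (Z i) = 0" for i
    using assms(3) by (auto simp: centered_def)
  have ind: "integrable M (\<lambda>\<omega>. indicator (D k) \<omega> :: real)" for k
    by (simp add: integrable_indicator_iff emeasure_eq_measure)
  have "expectation (\<lambda>\<omega>. Z (n + 1) \<omega> + a * (\<Sum>k=1..n. indicator (D k) \<omega>))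
      \<le> expectation (running_max Z (n + 1))"
  proof (rule integral_mono)
    show "integrable M (\<lambda>\<omega>. Z (n + 1) \<omega> + a * (\<Sum>k=1..n. indicator (D k) \<omega>))"
      using Z(1) ind by simp
    show "integrable M (running_max Z (n + 1))"
      using Z(1) by (intro integrable_running_max) auto
    show "Z (n + 1) \<omega> + a * (\<Sum>k=1..n. indicator (D k) \<omega>) \<le> running_max Z (n + 1) \<omega>"
      if "\<omega> \<in> space M" for \<omega>
      using running_max_ge_last_plus_drops[OF assms(5), of Z n \<omega>] that
      by (simp add: D_def indicator_def)
  qed
  \<comment> \<open>Centering removes \<open>Z (n + 1)\<close>. By linearity each of the
    \<open>n\<close> events \<open>D k\<close> contributes \<open>?p\<close>, whatever their
    dependence.\<close>
  also have "expectation (\<lambda>\<omega>. Z (n + 1) \<omega> + a * (\<Sum>k=1..n. indicator (D k) \<omega>)) = a * (real n * ?p)"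
    using Z ind prob_D by simp
  finally show ?thesis
    using assms(5,6) by (simp add: field_simps)
qed

end
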